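(* Let $S=\langle n_1,n_2,n_3,n_4\rangle$ be a 4-generated pseudo-symmetric numerical semigroup with parameters $\alpha_1,\alpha_2,\alpha_3,\alpha_4,\alpha_{21}$, where $\alpha_4=3$, and suppose $n_1<n_2<n_3<n_4$ and $\alpha_2>\alpha_{21}+1$. Let $k\ge 1$, $s\ge 0$ and $l\ge 0$ be the smallest integers (in these ranges) satisfying, respectively, $$(k-1)\alpha_1+(k+1)\alpha_{21}+\alpha_3>k\alpha_2+(k+1),$$ $$s\alpha_1+(2s+2)\alpha_{21}+\alpha_3>(2s+1)\alpha_2+(s+2),$$ $$l\alpha_1+(2l+3)\alpha_{21}+\alpha_3>(2l+2)\alpha_2+(l+1).$$ Then $$G=\{f_1,f_2,f_3,f_4,f_5,f_6,f_7,g_0,g_1,\dots,g_s,h_s,h_{s+1},\dots,h_l\}$$ is a standard basis for the toric ideal $I_S$, where $f_1=X_1^{\alpha_1}-X_3X_4^{2}$, $f_2=X_2^{\alpha_2}-X_1^{\alpha_{21}}X_4$, $f_3=X_3^{\alpha_3}-X_1^{\alpha_1-\alpha_{21}-1}X_2$, $f_4=X_4^{3}-X_1X_2^{\alpha_2-1}X_3^{\alpha_3-1}$, $f_5=X_1^{\alpha_{21}+1}X_3^{\alpha_3-1}-X_2X_4^{2}$, $f_6=X_1^{\alpha_1+\alpha_{21}}-X_2^{\alpha_2}X_3X_4$, $f_7=X_1^{\alpha_1+2\alpha_{21}}-X_2^{2\alpha_2}X_3$, $$g_i=X_2^{(2i+1)\alpha_2+1}X_4-X_1^{i\alpha_1+(2i+2)\alpha_{21}+1}X_3^{\alpha_3-(i+1)},\qquad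 h_j=X_2^{(2j+2)\alpha_2+1}-X_1^{j\alpha_1+(2j+3)\alpha_{21}+1}X_3^{\alpha_3-(j+1)}.$$
   Context: Parameters: a 4-generated numerical semigroup $S=\langle n_1,n_2,n_3,n_4\rangle$ ($\gcd(n_1,\dots,n_4)=1$) is pseudo-symmetric if and only if there are integers $\alpha_i>1$ ($1\le i\le 4$) and $\alpha_{21}$ with $0<\alpha_{21}<\alpha_1-1$ such that $n_1=\alpha_2\alpha_3(\alpha_4-1)+1$, $n_2=\alpha_{21}\alpha_3\alpha_4+(\alpha_1-\alpha_{21}-1)(\alpha_3-1)+\alpha_3$, $n_3=\alpha_1\alpha_4+(\alpha_1-\alpha_{21}-1)(\alpha_2-1)(\alpha_4-1)-\alpha_4+1$, $n_4=\alpha_1\alpha_2(\alpha_3-1)+\alpha_{21}(\alpha_2-1)+\alpha_2$. These integers are the parameters of $S$. Ideal: $K$ is an algebraically closed field, $A=K[X_1,X_2,X_3,X_4]$, and $I_S$ is the kernel of the $K$-algebra map $\phi:A\to K[t]$, $\phi(X_i)=t^{n_i}$. (It is known that $I_S=\langle f_1,\dots,f_5\rangle$.) Standard basis: fix a local degree ordering on monomials, i.e. a monomial ordering in which a monomial of smaller total degree is larger, with ties broken so that, when the two monomials of $g_i$ ($i<s$) or of $h_j$ ($s\le j<l$) have equal degree, the leading monomial is the one involving $X_1$. The leading monomials of the elements of $G$ are then: $X_3X_4^2$ ($f_1$), $X_1^{\alpha_{21}}X_4$ ($f_2$), $X_3^{\alpha_3}$ ($f_3$), $X_4^3$ ($f_4$),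 $X_2X_4^2$ ($f_5$), $X_2^{\alpha_2}X_3X_4$ ($f_6$), $X_2^{2\alpha_2}X_3$ ($f_7$), $X_1^{i\alpha_1+(2i+2)\alpha_{21}+1}X_3^{\alpha_3-(i+1)}$ ($g_i$, $i<s$), $X_2^{(2s+1)\alpha_2+1}X_4$ ($g_s$), $X_1^{j\alpha_1+(2j+3)\alpha_{21}+1}X_3^{\alpha_3-(j+1)}$ ($h_j$, $s\le j<l$), $X_2^{(2l+2)\alpha_2+1}$ ($h_l$). A finite set $G\subset I_S$ is a standard basis for $I_S$ if the ideal generated by the leading monomials of the nonzero elements of $I_S$ is generated by the leading monomials of the elements of $G$. *)

theory Defs
  imports
    "HOL-Analysis.Analysis"
    "HOL-Computational_Algebra.Polynomial"
    "HOL-Library.Poly_Mapping"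
    "HOL-Library.Numeral_Type"
begin

section \<open>Pseudo-symmetric numerical semigroups\<close>

definition generated_semigroup :: "('v::finite \<Rightarrow> nat) \<Rightarrow> nat set" where
  "generated_semigroup n = range (\<lambda>c. \<Sum>i\<in>UNIV. c i * n i)"

text \<open>The family \<open>n\<close>, indexed by a type with \<open>e\<close> elements, exhibits an \<open>e\<close>-generated
  numerical semigroup: its members have greatest common divisor 1 and none of them can be
  dropped from the generating system.\<close>

definition minimal_generators :: "('v::finite \<Rightarrow> nat) \<Rightarrow> bool" where
  "minimal_generators n \<longleftrightarrow>
     Gcd (range n) = 1 \<and>
     (\<forall>i. n i \<notin> range (\<lambda>c. \<Sum>j\<in>UNIV - {i}. c j * n j))"

definition frobenius_number :: "nat set \<Rightarrow> nat" where
  "frobenius_number S = Max (- S)"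

text \<open>Usually the condition is imposed on all integers outside \<open>S\<close>; for a negative integer \<open>x\<close>
  it holds automatically, as \<open>F - x\<close> then exceeds the Frobenius number \<open>F\<close>. The condition
  \<open>S \<noteq> UNIV\<close> excludes the semigroup of all natural numbers, whose Frobenius number is -1.\<close>

definition pseudo_symmetric :: "nat set \<Rightarrow> bool" where
  "pseudo_symmetric S \<longleftrightarrow>
     S \<noteq> UNIV \<and> even (frobenius_number S) \<and>
     (\<forall>x. x \<notin> S \<and> 2 * x \<noteq> frobenius_number S \<longrightarrow> frobenius_number S - x \<in> S)"

text \<open>The four generators and the four variables are indexed by the type \<open>4\<close> of integers
  modulo 4, whose elements are 1, 2, 3 and 4 = 0. All parameters are positive, and every
  subtraction below is between natural numbers whose difference is nonnegative.\<close>

definition pseudo_symmetric_parameters ::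
  "(4 \<Rightarrow> nat) \<Rightarrow> nat \<Rightarrow> nat \<Rightarrow> nat \<Rightarrow> nat \<Rightarrow> nat \<Rightarrow> bool" where
  "pseudo_symmetric_parameters n \<alpha>1 \<alpha>2 \<alpha>3 \<alpha>4 \<alpha>21 \<longleftrightarrow>
     \<alpha>1 > 1 \<and> \<alpha>2 > 1 \<and> \<alpha>3 > 1 \<and> \<alpha>4 > 1 \<and> 0 < \<alpha>21 \<and> \<alpha>21 < \<alpha>1 - 1 \<and>
     n 1 = \<alpha>2 * \<alpha>3 * (\<alpha>4 - 1) + 1 \<and>
     n 2 = \<alpha>21 * \<alpha>3 * \<alpha>4 + (\<alpha>1 - \<alpha>21 - 1) * (\<alpha>3 - 1) + \<alpha>3 \<and>
     n 3 = (\<alpha>1 * \<alpha>4 + (\<alpha>1 - \<alpha>21 - 1) * (\<alpha>2 - 1) * (\<alpha>4 - 1) - \<alpha>4) + 1 \<and>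
     n 4 = \<alpha>1 * \<alpha>2 * (\<alpha>3 - 1) + \<alpha>21 * (\<alpha>2 - 1) + \<alpha>2"


section \<open>Polynomials and toric ideals\<close>

text \<open>Monomials are identified with their exponent vectors, so that their product is \<open>+\<close>.\<close>

type_synonym 'v mon = "'v \<Rightarrow>\<^sub>0 nat"
type_synonym ('v, 'a) mpoly = "'v mon \<Rightarrow>\<^sub>0 'a"

definition X :: "'v \<Rightarrow> ('v, 'a::comm_ring_1) mpoly" where
  "X i = Poly_Mapping.single (Poly_Mapping.single i 1) 1"

definition toric_map :: "('v::finite \<Rightarrow> nat) \<Rightarrow> ('v, 'a::comm_ring_1) mpoly \<Rightarrow> 'a poly" where
  "toric_map n p =
     (\<Sum>m\<in>Poly_Mapping.keys p. smult (Poly_Mapping.lookup p m)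
        (\<Prod>i\<in>UNIV. monom 1 (n i) ^ Poly_Mapping.lookup m i))"

definition toric_ideal :: "('v::finite \<Rightarrow> nat) \<Rightarrow> ('v, 'a::comm_ring_1) mpoly set" where
  "toric_ideal n = {p. toric_map n p = 0}"

text \<open>The ideal generated by a set is its span in the ring regarded as a module over itself.\<close>

lemma module_self: "module ((*) :: 'a::comm_ring_1 \<Rightarrow> 'a \<Rightarrow> 'a)"
  by unfold_locales (simp_all add: algebra_simps)

abbreviation ideal_generated :: "'a::comm_ring_1 set \<Rightarrow> 'a set" where
  "ideal_generated B \<equiv> module.span (*) B"


section \<open>Local degree orderings and standard bases\<close>

definition mdeg :: "'v::finite mon \<Rightarrow> nat" where
  "mdeg m = (\<Sum>i\<in>UNIV. Poly_Mapping.lookup m i)"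

text \<open>Monomial orderings are represented by their strict part; they need not be well-founded.\<close>

definition monomial_ordering :: "('v mon \<Rightarrow> 'v mon \<Rightarrow> bool) \<Rightarrow> bool" where
  "monomial_ordering lt \<longleftrightarrow>
     irreflp lt \<and> transp lt \<and> totalp lt \<and> (\<forall>a b c. lt a b \<longrightarrow> lt (a + c) (b + c))"

definition local_degree_ordering :: "('v::finite mon \<Rightarrow> 'v mon \<Rightarrow> bool) \<Rightarrow> bool" where
  "local_degree_ordering lt \<longleftrightarrow>
     monomial_ordering lt \<and> (\<forall>a b. mdeg a < mdeg b \<longrightarrow> lt b a)"

definition leading_monomial ::
  "('v mon \<Rightarrow> 'v mon \<Rightarrow> bool) \<Rightarrow> ('v, 'a::zero) mpoly \<Rightarrow> 'v mon" where
  "leading_monomial lt p =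
     (THE m. m \<in> Poly_Mapping.keys p \<and> (\<forall>m'\<in>Poly_Mapping.keys p. m' \<noteq> m \<longrightarrow> lt m' m))"

definition leading_ideal ::
  "('v mon \<Rightarrow> 'v mon \<Rightarrow> bool) \<Rightarrow> ('v, 'a::comm_ring_1) mpoly set \<Rightarrow> ('v, 'a) mpoly set" where
  "leading_ideal lt P =
     ideal_generated ((\<lambda>p. Poly_Mapping.single (leading_monomial lt p) 1) ` (P - {0}))"

definition standard_basis ::
  "('v mon \<Rightarrow> 'v mon \<Rightarrow> bool) \<Rightarrow> ('v, 'a::comm_ring_1) mpoly set \<Rightarrow> ('v, 'a) mpoly set \<Rightarrow> bool" where
  "standard_basis lt I G \<longleftrightarrow>
     finite G \<and> G \<subseteq> I \<and> leading_ideal lt I = leading_ideal lt G"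

definition mon4 :: "nat \<Rightarrow> nat \<Rightarrow> nat \<Rightarrow> nat \<Rightarrow> 4 mon" where
  "mon4 e1 e2 e3 e4 =
     Poly_Mapping.single 1 e1 + Poly_Mapping.single 2 e2 +
     Poly_Mapping.single 3 e3 + Poly_Mapping.single 4 e4"


definition is_least :: "nat \<Rightarrow> nat set \<Rightarrow> bool" where
  "is_least k A \<longleftrightarrow> k \<in> A \<and> (\<forall>x\<in>A. k \<le> x)"

end

theory Submission
  imports Defs
begin

text \<open>Since the toric ideal is homogeneous for the grading with \<open>X\<^sub>i\<close> in degree \<open>n\<^sub>i\<close> and has one-dimensional
  quotient in every degree of the semigroup, exactly the least monomial of each degree fails to be
  a leading monomial. So a set of homogeneous binomials of the ideal is a standard basis as soon as
  two distinct monomials that avoid its leading monomials never have the same degree. Here the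
  difference of the exponent vectors of two monomials of the same degree is an integral combination
  of the exponent vectors of \<open>f\<^sub>1\<close>, \<open>f\<^sub>2\<close> and \<open>f\<^sub>3\<close>, and a case distinction on its last entry,
  which lies between -2 and 2, always exhibits a forbidden divisor.

  In the integer lemmas, \<open>a\<close>, \<open>b\<close>, \<open>c\<close>, \<open>d\<close> stand for \<open>\<alpha>\<^sub>1\<close>, \<open>\<alpha>\<^sub>2\<^sub>1\<close>, \<open>\<alpha>\<^sub>3\<close>, \<open>\<alpha>\<^sub>2\<close>, and \<open>\<alpha>\<^sub>4 = 3\<close>.\<close>

section \<open>Arithmetic of the parameters\<close>

text \<open>These are the degree comparisons that decide the leading monomials of
  \<open>f\<^sub>3\<close>, \<open>f\<^sub>7\<close>, \<open>f\<^sub>1\<close> and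
  \<open>f\<^sub>5\<close>, in this order; they are extracted from the order of the
  generators.\<close>

lemma parameter_bounds:
  fixes a b c d :: int
  assumes "0 < b" "b + 1 < a" "2 \<le> c" "b + 2 \<le> d"
    and n12: "2*d*c + 1 < 2*b*c + a*c - a + b + 1"
    and n23: "2*b*c + a*c - a + b + 1 < a + 2*a*d - 2*b*d + 2*b - 2*d"
    and n34: "a + 2*a*d - 2*b*d + 2*b - 2*d < a*d*c - a*d + b*d - b + d"
  shows "c < a - b" "2 * d + 1 < a + 2 * b" "3 < a" "3 < b + c"
proof -
  have le: "2 * d + 1 \<le> a + 2 * b"
  proof (rule ccontr)
    assume "\<not> ?thesis"
    then have "a + 2*b \<le> 2*d" by simp
    then have "(a + 2*b) * c \<le> 2*d*c"
      using assms by (intro mult_right_mono) auto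
    with n12 assms show False by (simp add: algebra_simps)
  qed
  show less: "c < a - b"
  proof (rule ccontr)
    assume "\<not> ?thesis"
    then have "(a + 2*b) * (a - b) \<le> (a + 2*b) * c"
      using assms by (intro mult_left_mono) auto
    \<comment> \<open>Inserting both product bounds into \<open>n23\<close> makes the two sides
      agree exactly, so its strictness is contradicted.\<close>
    moreover have "(a - b - 1) * (2*d) \<le> (a - b - 1) * (a + 2*b - 1)"
      using assms le by (intro mult_left_mono) auto
    ultimately show False using n23 by (simp add: algebra_simps)
  qed
  show "2 * d + 1 < a + 2 * b"
  proof (rule ccontr)
    assume "\<not> ?thesis"
    \<comment> \<open>In the case of equality, \<open>n12\<close> collapses to a - b < c.\<close>
    with le have e: "a = 2*d + 1 - 2*b" by simp
    show False using n12 less unfolding e by (simp add: algebra_simps)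
  qed
  have "2 * (b + 2) * c \<le> 2 * d * c"
    using assms by (intro mult_right_mono) auto
  \<comment> \<open>This says (a - 4) * c > a - b > 0, which excludes a <= 4.\<close>
  then have ac: "4 * c < a * c - a + b" using n12 by (simp add: algebra_simps)
  have "a \<ge> 5"
  proof (rule ccontr)
    assume "\<not> ?thesis"
    then have "a * c \<le> 4 * c" using assms by (intro mult_right_mono) auto
    with ac assms show False by simp
  qed
  then show "3 < a" by simp
  show "3 < b + c"
  proof (rule ccontr)
    assume "\<not> ?thesis"
    \<comment> \<open>For this only remaining pair, \<open>n34\<close> and a >= 5 give d > a + 3,
      while \<open>n12\<close> gives 4 * d < a + 5.\<close>
    then have e: "b = 1" "c = 2" using assms by auto
    have "5 * d \<le> a * d" using \<open>a \<ge> 5\<close> assms by (intro mult_right_mono) auto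
    then show False using n34 n12 \<open>a \<ge> 5\<close> unfolding e by (simp add: algebra_simps)
  qed
qed

text \<open>The vector \<open>w\<close> is \<open>p\<close> times the exponent vector of \<open>f\<^sub>1\<close> plus \<open>r\<close> times that of \<open>f\<^sub>3\<close> plus a multiple of
  that of \<open>f\<^sub>2\<close>; the latter coefficient is \<open>-2 p - w\<^sub>4\<close> and has been eliminated.\<close>

lemma kernel_lattice:
  fixes a b c d w1 w2 w3 w4 :: int
  defines "n1 \<equiv> 2*d*c + 1" and "n2 \<equiv> 2*b*c + a*c - a + b + 1"
  assumes "coprime n1 n2" "n1 \<noteq> 0"
    and wt: "n1 * w1 + n2 * w2 + (a + 2*a*d - 2*b*d + 2*b - 2*d) * w3
           + (a*d*c - a*d + b*d - b + d) * w4 = 0"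
  obtains p r where "w1 = (a + 2*b)*p + b*w4 - (a - b - 1)*r"
    "w2 = - 2*d*p - d*w4 - r" "w3 = c*r - p"
proof -
  \<comment> \<open>The third generator is (a + 2*b) * n1 - 2*d * n2 and the fourth is d * n2 - b *
    n1, so the relation can be sorted by multiples of n1 and n2.\<close>
  have "n2 * (2*d*w3 - d*w4 - w2) = n1 * (w1 + (a + 2*b)*w3 - b*w4)"
    using wt unfolding n1_def n2_def by algebra
  then have "n1 dvd n2 * (2*d*w3 - d*w4 - w2)" by simp
  with \<open>coprime n1 n2\<close> have "n1 dvd 2*d*w3 - d*w4 - w2"
    using coprime_dvd_mult_right_iff by blast
  then obtain r where r: "2*d*w3 - d*w4 - w2 = n1 * r" by blast
  define p where "p = c*r - w3"
  have w3: "w3 = c*r - p" by (simp add: p_def)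
  have w2: "w2 = - 2*d*p - d*w4 - r"
    using r unfolding w3 n1_def by algebra
  have "n1 * w1 = n1 * ((a + 2*b)*p + b*w4 - (a - b - 1)*r)"
    using wt unfolding w2 w3 n1_def n2_def by algebra
  with \<open>n1 \<noteq> 0\<close> have "w1 = (a + 2*b)*p + b*w4 - (a - b - 1)*r" by simp
  with w2 w3 show ?thesis using that by blast
qed

text \<open>Exponents of the monomials divisible by none of the leading monomials of \<open>G\<close>.\<close>

definition standard_exponents ::
  "int \<Rightarrow> int \<Rightarrow> int \<Rightarrow> int \<Rightarrow> int \<Rightarrow> int \<Rightarrow> int \<Rightarrow> int \<Rightarrow> int \<Rightarrow> int \<Rightarrow> bool" where
  "standard_exponents a b c d s l x1 x2 x3 x4 \<longleftrightarrow>
     0 \<le> x1 \<and> 0 \<le> x2 \<and> 0 \<le> x3 \<and> 0 \<le> x4 \<and>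
     \<not> (1 \<le> x3 \<and> 2 \<le> x4) \<and> \<not> (b \<le> x1 \<and> 1 \<le> x4) \<and> x3 < c \<and> x4 < 3 \<and>
     \<not> (1 \<le> x2 \<and> 2 \<le> x4) \<and> \<not> (d \<le> x2 \<and> 1 \<le> x3 \<and> 1 \<le> x4) \<and>
     \<not> (2*d \<le> x2 \<and> 1 \<le> x3) \<and>
     (\<forall>i. 0 \<le> i \<and> i < s \<longrightarrow> \<not> (i*a + (2*i + 2)*b + 1 \<le> x1 \<and> c - (i + 1) \<le> x3)) \<and>
     \<not> ((2 * s + 1)*d + 1 \<le> x2 \<and> 1 \<le> x4) \<and>
     (\<forall>j. s \<le> j \<and> j < l \<longrightarrow> \<not> (j*a + (2*j + 3)*b + 1 \<le> x1 \<and> c - (j + 1) \<le> x3)) \<and>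
     x2 < (2*l + 2)*d + 1"

text \<open>The hypothesis \<open>r\<close> orients the difference u - v: the first nonzero entry
  among r, p, u4 - v4 is positive. With this orientation fixed, each value of u4 - v4 determines
  whether u or v is a multiple of a forbidden monomial.\<close>

lemma standard_exponents_unique_aux:
  fixes a b c d s l p r :: int
  assumes par: "0 < b" "b + 1 < a" "2 \<le> c" "b + 2 \<le> d" "0 \<le> s" "s \<le> l" "l < c"
    and u: "standard_exponents a b c d s l u1 u2 u3 u4"
    and v: "standard_exponents a b c d s l v1 v2 v3 v4"
    and w1: "u1 - v1 = (a + 2*b)*p + b*(u4 - v4) - (a - b - 1)*r"
    and w2: "u2 - v2 = - 2*d*p - d*(u4 - v4) - r"
    and w3: "u3 - v3 = c*r - p"
    and r: "0 < r \<or> r = 0 \<and> (0 < p \<or> p = 0 \<and> v4 < u4)"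
  shows False
proof -
  have u0: "0 \<le> u1" "0 \<le> u2" "0 \<le> u3" "0 \<le> u4" "u3 < c" "u4 < 3" "u2 < (2*l + 2)*d + 1"
    and u34: "u3 < 1 \<or> u4 < 2" and u14: "u1 < b \<or> u4 < 1" and u24: "u2 < 1 \<or> u4 < 2"
    and u234: "u2 < d \<or> u3 < 1 \<or> u4 < 1" and u23: "u2 < 2*d \<or> u3 < 1"
    and u24s: "u2 < (2 * s + 1)*d + 1 \<or> u4 < 1"
    using u unfolding standard_exponents_def by (simp_all only: not_le de_Morgan_conj simp_thms)
  have u_g: "u1 < i*a + (2*i + 2)*b + 1 \<or> u3 < c - (i + 1)" if "0 \<le> i" "i < s" for i
    using u that unfolding standard_exponents_def by (meson not_le)
  have u_h: "u1 < j*a + (2*j + 3)*b + 1 \<or> u3 < c - (j + 1)" if "s \<le> j" "j < l" for j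
    using u that unfolding standard_exponents_def by (meson not_le)
  have v0: "0 \<le> v1" "0 \<le> v2" "0 \<le> v3" "0 \<le> v4" "v3 < c" "v4 < 3" "v2 < (2*l + 2)*d + 1"
    and v34: "v3 < 1 \<or> v4 < 2" and v14: "v1 < b \<or> v4 < 1" and v24: "v2 < 1 \<or> v4 < 2"
    and v234: "v2 < d \<or> v3 < 1 \<or> v4 < 1" and v23: "v2 < 2*d \<or> v3 < 1"
    and v24s: "v2 < (2 * s + 1)*d + 1 \<or> v4 < 1"
    using v unfolding standard_exponents_def by (simp_all only: not_le de_Morgan_conj simp_thms)
  consider "u4 - v4 = 0" | "u4 - v4 = 1" | "u4 - v4 = 2" | "u4 - v4 = -1" | "u4 - v4 = -2"
    using u0 v0 by linarith
  note w4_cases = this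
  \<comment> \<open>Naming the products keeps the relations linear for the case
    distinctions.\<close>
  define D where "D = d * p"
  define E where "E = (a + 2*b) * p"
  define R where "R = (a - b - 1) * r"
  define C where "C = c * r"
  have w1: "u1 - v1 = E + b*(u4 - v4) - R" using w1 by (simp add: E_def R_def)
  have w2: "u2 - v2 = - 2*D - d*(u4 - v4) - r" using w2 by (simp add: D_def)
  have w3: "u3 - v3 = C - p" using w3 by (simp add: C_def)
  show False
  proof (cases "r = 0")
    case True
    then have R: "R = 0" and C: "C = 0" by (simp_all add: R_def C_def)
    show False
    proof (cases "p = 0")
      case True
      then have "E = 0" by (simp add: E_def)
      have "b * 1 \<le> b * (u4 - v4)" using r par True \<open>r = 0\<close> by (intro mult_left_mono) auto
      then show False using w1 R \<open>E = 0\<close> u0 u14 v0 r True \<open>r = 0\<close> by linarith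
    next
      case False
      then have p: "p \<ge> 1" using r True by auto
      have dp: "d * 1 \<le> D" and ap: "(a + 2*b) * 1 \<le> E"
        unfolding D_def E_def using p par by (auto intro!: mult_left_mono)
      have v3: "v3 \<ge> 1" using w3 C p u0 by linarith
      \<comment> \<open>As X3 divides v, the monomial v is a multiple of the leading monomial of
        \<open>f\<^sub>7\<close>, \<open>f\<^sub>6\<close> or \<open>f\<^sub>1\<close> when u4 - v4
        is 0, -1 or -2; for positive u4 - v4, u is a multiple of that of
        \<open>f\<^sub>2\<close>.\<close>
      from w4_cases show False
      proof cases
        case 1
        then show False using dp v3 True w2 v23 u0 by simp
      next
        case 2
        then show False using ap R w1 par u14 u0 v0 by simp
      next
        case 3
        then show False using ap R w1 par u14 u0 v0 by simp
      next
        case 4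
        then show False using dp v3 True w2 u0 v234 by simp
      next
        case 5
        then show False using v3 u0 v34 by simp
      qed
    qed
  next
    case False
    then have r1: "r \<ge> 1" using r by auto
    have p_lower: "C - c < p" using w3 u0 v0 by linarith
    have "1 * (r - 1) \<le> c * (r - 1)" using par r1 by (intro mult_right_mono) auto
    then have pr: "r \<le> p" using p_lower unfolding C_def right_diff_distrib by linarith
    then have p1: "p \<ge> 1" using r1 by auto
    have dp: "d * 1 \<le> D" unfolding D_def using p1 par by (intro mult_left_mono) auto
    \<comment> \<open>The coefficient of p in the first coordinate exceeds that of r by 3*b + 1, so
      \<open>pr\<close> makes p outweigh r.\<close>
    have "(a - b - 1) * r \<le> (a - b - 1) * p" using par pr by (intro mult_left_mono) auto
    moreover have "0 < (3*b + 1) * p" using par p1 by auto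
    ultimately have ap: "R < E" by (simp add: R_def E_def algebra_simps)
    have r_eq: "r = 1" if "p < c"
    proof (rule ccontr)
      assume "r \<noteq> 1"
      then have "c * 1 \<le> c * (r - 1)" using r1 par by (intro mult_left_mono) auto
      with p_lower that show False unfolding C_def right_diff_distrib by linarith
    qed
    from w4_cases show False
    proof cases
      case 1
      have v3: "v3 = 0" using w2 1 dp u0 v0 v23 r1 par by simp
      \<comment> \<open>The leading monomial of \<open>h\<^sub>l\<close> bounds v2 and thereby p;
        then p < c forces r = 1, and u is a multiple of the leading monomial of
        \<open>g\<^sub>i\<close> or \<open>h\<^sub>i\<close> for i = p - 1.\<close>
      have "d * p < d * (l + 1)"
        using w2 1 u0 v0 r1 unfolding D_def by (simp add: distrib_right distrib_left mult.commute)
      then have pl: "p \<le> l" using par by simp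
      then have "r = 1" using r_eq par by simp
      define i where "i = p - 1"
      have p: "p = i + 1" by (simp add: i_def)
      have u3: "c - (i + 1) \<le> u3" using w3 p v3 unfolding \<open>r = 1\<close> C_def by simp
      have u1: "i*a + (2*i + 3)*b + 1 \<le> u1"
        using w1 1 v0 unfolding \<open>r = 1\<close> p E_def R_def by (simp add: algebra_simps)
      have "0 \<le> i" "i < l" using p pl p1 by auto
      show False
      proof (cases "i < s")
        case True
        have "i*a + (2*i + 2)*b + 1 \<le> u1" using u1 par by (simp add: algebra_simps)
        then show False using u_g[OF \<open>0 \<le> i\<close> True] u3 by linarith
      next
        case False
        then show False using u_h[of i] u1 u3 \<open>i < l\<close> by linarith
      qed
    next
      case 2
      then show False using w1 ap u14 u0 v0 par by simp
    next
      case 3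
      then show False using w1 ap u14 u0 v0 par by simp
    next
      case 4
      then have "v4 \<ge> 1" using u0 by linarith
      have v2: "v2 = u2 + 2*D - d + r" using w2 4 by simp
      have v3: "v3 = 0" using v2 \<open>v4 \<ge> 1\<close> dp u0 v0 v234 r1 par by linarith
      \<comment> \<open>Here v4 is positive, so the bound on v2 comes from \<open>g\<^sub>s\<close>
        and gives p <= s; hence u is a multiple of the leading monomial of \<open>g\<^sub>i\<close>
        with i = p - 1 < s.\<close>
      have "d * p < d * (s + 1)"
        using v2 \<open>v4 \<ge> 1\<close> u0 v24s r1 unfolding D_def
        by (simp add: distrib_right distrib_left mult.commute)
      then have ps: "p \<le> s" using par by simp
      then have "r = 1" using r_eq par by simp
      define i where "i = p - 1"
      have p: "p = i + 1" by (simp add: i_def)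
      have u3: "c - (i + 1) \<le> u3" using w3 p v3 unfolding \<open>r = 1\<close> C_def by simp
      have u1: "i*a + (2*i + 2)*b + 1 \<le> u1"
        using w1 4 v0 unfolding \<open>r = 1\<close> p E_def R_def by (simp add: algebra_simps)
      have "0 \<le> i" "i < s" using p ps p1 by auto
      then show False using u_g u1 u3 by (meson not_le)
    next
      case 5
      then have "v4 = 2" using u0 v0 by linarith
      then show False using w2 5 dp u0 v0 v24 r1 by simp
    qed
  qed
qed

text \<open>Exchanging u and v negates r, p and u4 - v4, so one of the two orientations satisfies
  the sign hypothesis of the auxiliary lemma unless all three vanish.\<close>

lemma standard_exponents_unique:
  fixes a b c d s l :: int
  assumes par: "0 < b" "b + 1 < a" "2 \<le> c" "b + 2 \<le> d" "0 \<le> s" "s \<le> l" "l < c"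
    and cop: "coprime (2*d*c + 1) (2*b*c + a*c - a + b + 1)"
    and u: "standard_exponents a b c d s l u1 u2 u3 u4"
    and v: "standard_exponents a b c d s l v1 v2 v3 v4"
    and wt: "(2*d*c + 1) * (u1 - v1) + (2*b*c + a*c - a + b + 1) * (u2 - v2)
        + (a + 2*a*d - 2*b*d + 2*b - 2*d) * (u3 - v3)
        + (a*d*c - a*d + b*d - b + d) * (u4 - v4) = 0"
  shows "u1 = v1 \<and> u2 = v2 \<and> u3 = v3 \<and> u4 = v4"
proof -
  have "0 \<le> d * c" using par by auto
  then have "2*d*c + 1 \<noteq> 0" by (simp add: algebra_simps)
  then obtain p r where
    w1: "u1 - v1 = (a + 2*b)*p + b*(u4 - v4) - (a - b - 1)*r" and
    w2: "u2 - v2 = - 2*d*p - d*(u4 - v4) - r" and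
    w3: "u3 - v3 = c*r - p"
    using kernel_lattice[OF cop _ wt] by blast
  have w1': "v1 - u1 = (a + 2*b)*(-p) + b*(v4 - u4) - (a - b - 1)*(-r)"
    and w2': "v2 - u2 = - 2*d*(-p) - d*(v4 - u4) - (-r)"
    and w3': "v3 - u3 = c*(-r) - (-p)"
    using w1 w2 w3 by (simp_all add: algebra_simps)
  note A = standard_exponents_unique_aux[OF par u v w1 w2 w3]
    and B = standard_exponents_unique_aux[OF par v u w1' w2' w3']
  from A B have "r = 0" "p = 0" "u4 = v4"
    by (smt (verit))+
  with w1 w2 w3 show ?thesis by simp
qed

section \<open>Standard bases of toric ideals made of binomials\<close>

definition weight :: "('v::finite \<Rightarrow> nat) \<Rightarrow> 'v mon \<Rightarrow> nat" where
  "weight n m = (\<Sum>i\<in>UNIV. Poly_Mapping.lookup m i * n i)"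

lemma weight_add: "weight n (u + v) = weight n u + weight n v"
  by (simp add: weight_def lookup_add distrib_right sum.distrib)

lemma toric_map_eq:
  fixes n :: "'v::finite \<Rightarrow> nat" and p :: "('v, 'a::comm_ring_1) mpoly"
  shows "toric_map n p = (\<Sum>m\<in>Poly_Mapping.keys p. monom (Poly_Mapping.lookup p m) (weight n m))"
proof -
  have "(\<Prod>i\<in>UNIV. monom (1::'a) (n i) ^ Poly_Mapping.lookup m i) = monom 1 (weight n m)"
    for m :: "'v mon"
  proof -
    have "(\<Prod>i\<in>A. monom (1::'a) (n i) ^ Poly_Mapping.lookup m i)
        = monom 1 (\<Sum>i\<in>A. Poly_Mapping.lookup m i * n i)" if "finite A" for A
      using that by (induction A) (simp_all add: monom_power mult_monom mult.commute)
    then show ?thesis by (simp add: weight_def)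
  qed
  then show ?thesis by (simp add: toric_map_def smult_monom)
qed

lemma keys_binomial:
  fixes u v :: "'v mon"
  assumes "u \<noteq> v"
  shows "Poly_Mapping.keys (Poly_Mapping.single u (1::'a::comm_ring_1) - Poly_Mapping.single v 1) = {u, v}"
  using assms by (auto simp: in_keys_iff lookup_minus lookup_single when_def split: if_splits)

lemma binomial_in_toric_ideal:
  assumes "u \<noteq> v" "weight n u = weight n v"
  shows "Poly_Mapping.single u (1::'a::comm_ring_1) - Poly_Mapping.single v 1 \<in> toric_ideal n"
  using assms
  by (simp add: toric_ideal_def toric_map_eq keys_binomial lookup_minus lookup_single when_def
      add_monom)

lemma monomial_ordering_asymp_transp:
  assumes "monomial_ordering lt"
  shows "asymp_on A lt" "transp_on A lt"
  using assms unfolding monomial_ordering_def asymp_on_def irreflp_on_def transp_on_def by blast+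

lemma leading_monomial_eqI:
  assumes "monomial_ordering lt" "m \<in> Poly_Mapping.keys p"
    and "\<And>m'. m' \<in> Poly_Mapping.keys p \<Longrightarrow> m' \<noteq> m \<Longrightarrow> lt m' m"
  shows "leading_monomial lt p = m"
  unfolding leading_monomial_def
proof (rule the_equality)
  show "m \<in> Poly_Mapping.keys p \<and> (\<forall>m'\<in>Poly_Mapping.keys p. m' \<noteq> m \<longrightarrow> lt m' m)"
    using assms by blast
next
  fix x assume "x \<in> Poly_Mapping.keys p \<and> (\<forall>m'\<in>Poly_Mapping.keys p. m' \<noteq> x \<longrightarrow> lt m' x)"
  then show "x = m"
    using assms unfolding monomial_ordering_def by (metis irreflpD transpD)
qed

text \<open>The support is finite, so a maximum exists although the ordering may fail to be
  well-founded.\<close>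

lemma leading_monomial_properties:
  assumes lt: "monomial_ordering lt" and "p \<noteq> 0"
  shows "leading_monomial lt p \<in> Poly_Mapping.keys p"
    and "\<And>m'. m' \<in> Poly_Mapping.keys p \<Longrightarrow> m' \<noteq> leading_monomial lt p
      \<Longrightarrow> lt m' (leading_monomial lt p)"
proof -
  obtain m where "m \<in> Poly_Mapping.keys p"
    and "\<And>x. x \<in> Poly_Mapping.keys p \<Longrightarrow> x \<noteq> m \<Longrightarrow> \<not> lt m x"
    using Finite_Set.bex_max_element[OF finite_keys monomial_ordering_asymp_transp[OF lt]] \<open>p \<noteq> 0\<close>
    by (metis keys_eq_empty)
  then have m: "m \<in> Poly_Mapping.keys p"
      "\<And>m'. m' \<in> Poly_Mapping.keys p \<Longrightarrow> m' \<noteq> m \<Longrightarrow> lt m' m"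
    using lt unfolding monomial_ordering_def by (auto dest: totalpD)
  with leading_monomial_eqI[OF lt] have "leading_monomial lt p = m" by blast
  with m show "leading_monomial lt p \<in> Poly_Mapping.keys p"
    "\<And>m'. m' \<in> Poly_Mapping.keys p \<Longrightarrow> m' \<noteq> leading_monomial lt p
      \<Longrightarrow> lt m' (leading_monomial lt p)"
    by auto
qed

text \<open>This supplies a least monomial of each occurring weight, which a local ordering does not
  provide by itself.\<close>

lemma finite_weight_fibre:
  assumes "\<And>i. 0 < n i"
  shows "finite {m :: 'v::finite mon. weight n m = w}"
proof (rule finite_imageD)
  have "Poly_Mapping.lookup m i \<le> w" if "weight n m = w" for m i
  proof -
    have "Poly_Mapping.lookup m i * 1 \<le> Poly_Mapping.lookup m i * n i"
      using assms[of i] by (intro mult_left_mono) auto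
    also have "\<dots> \<le> weight n m" unfolding weight_def by (rule member_le_sum) auto
    finally show ?thesis using that by simp
  qed
  then have "Poly_Mapping.lookup ` {m. weight n m = w} \<subseteq> (\<Pi>\<^sub>E i\<in>UNIV. {..w})" by auto
  then show "finite (Poly_Mapping.lookup ` {m. weight n m = w})"
    by (rule finite_subset) (intro finite_PiE; simp)
  show "inj_on Poly_Mapping.lookup {m. weight n m = w}"
    by (simp add: inj_on_def lookup_inject)
qed

text \<open>The least monomial of a weight is always standard for \<open>G\<close>. If the leading
  monomial of an element of the ideal were standard too, uniqueness would identify the two, but
  cancellation forces a smaller monomial of the same weight.\<close>

lemma standard_basis_if_standard_unique:
  fixes n :: "'v::finite \<Rightarrow> nat" and G :: "('v, 'a::comm_ring_1) mpoly set"
  assumes lt: "monomial_ordering lt" and pos: "\<And>i. 0 < n i" and "finite G"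
    and binom: "\<And>g. g \<in> G \<Longrightarrow> \<exists>u v. u \<noteq> v \<and> weight n u = weight n v \<and>
       g = Poly_Mapping.single u 1 - Poly_Mapping.single v 1"
    and uniq: "\<And>m m'. weight n m = weight n m' \<Longrightarrow>
       (\<And>g c. g \<in> G \<Longrightarrow> m \<noteq> c + leading_monomial lt g) \<Longrightarrow>
       (\<And>g c. g \<in> G \<Longrightarrow> m' \<noteq> c + leading_monomial lt g) \<Longrightarrow> m = m'"
  shows "standard_basis lt (toric_ideal n) G"
proof -
  interpret self: module "(*) :: ('v, 'a) mpoly \<Rightarrow> ('v, 'a) mpoly \<Rightarrow> ('v, 'a) mpoly" by (rule module_self)
  have G_sub: "G \<subseteq> toric_ideal n" using binom binomial_in_toric_ideal by blast
  have nz: "g \<noteq> 0" if "g \<in> G" for g using binom[OF that] keys_binomial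
    by (metis insert_not_empty keys_zero)
  have tail: "\<exists>t. weight n t = weight n (leading_monomial lt g) \<and> lt t (leading_monomial lt g)"
    if "g \<in> G" for g
  proof -
    from binom[OF that] obtain u v where uv: "u \<noteq> v" "weight n u = weight n v"
      and g: "g = Poly_Mapping.single u 1 - Poly_Mapping.single v 1" by blast
    have "Poly_Mapping.keys g = {u, v}" using keys_binomial[OF uv(1)] g by simp
    then show ?thesis
      using leading_monomial_properties[OF lt nz[OF that]] uv by (metis insert_iff singletonD)
  qed
  \<comment> \<open>Replacing the leading monomial of g by its tail lowers a multiple of it without
    changing the weight.\<close>
  have least_standard: "m \<noteq> c + leading_monomial lt g"
    if "g \<in> G" and m: "\<And>m'. weight n m' = weight n m \<Longrightarrow> \<not> lt m' m" for m c g
  proof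
    assume e: "m = c + leading_monomial lt g"
    obtain t where t: "weight n t = weight n (leading_monomial lt g)" "lt t (leading_monomial lt g)"
      using tail[OF \<open>g \<in> G\<close>] by blast
    then have "lt (c + t) m" using lt e unfolding monomial_ordering_def by (metis add.commute)
    then show False using m[of "c + t"] t(1) e by (simp add: weight_add)
  qed
  have divisible: "\<exists>g c. g \<in> G \<and> leading_monomial lt p = c + leading_monomial lt g"
    if "p \<in> toric_ideal n" "p \<noteq> 0" for p :: "('v, 'a) mpoly"
  proof (rule ccontr)
    assume no: "\<not> ?thesis"
    define m where "m = leading_monomial lt p"
    have m: "m \<in> Poly_Mapping.keys p" "\<And>m'. m' \<in> Poly_Mapping.keys p \<Longrightarrow> m' \<noteq> m \<Longrightarrow> lt m' m"
      using leading_monomial_properties[OF lt \<open>p \<noteq> 0\<close>] unfolding m_def by auto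
    \<comment> \<open>If m were alone in its weight, the coefficient of the image at that weight
      would be the nonzero coefficient of m.\<close>
    have "\<exists>m'\<in>Poly_Mapping.keys p. m' \<noteq> m \<and> weight n m' = weight n m"
    proof (rule ccontr)
      assume "\<not> ?thesis"
      then have "coeff (toric_map n p) (weight n m)
          = (\<Sum>m'\<in>Poly_Mapping.keys p. if m' = m then Poly_Mapping.lookup p m else 0)"
        unfolding toric_map_eq coeff_sum by (intro sum.cong) auto
      also have "\<dots> = Poly_Mapping.lookup p m" using m(1) by simp
      finally show False using m(1) \<open>p \<in> toric_ideal n\<close> by (simp add: toric_ideal_def in_keys_iff)
    qed
    then obtain m' where m': "weight n m' = weight n m" "lt m' m" using m(2) by blast
    define F where "F = {x. weight n x = weight n m}"
    have F: "finite F" "F \<noteq> {}"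
      unfolding F_def using finite_weight_fibre[where n = n, OF pos] by auto
    obtain m0 where "m0 \<in> F" "\<And>x. x \<in> F \<Longrightarrow> x \<noteq> m0 \<Longrightarrow> \<not> lt x m0"
      using Finite_Set.bex_min_element[OF F(1) monomial_ordering_asymp_transp[OF lt] F(2)] by blast
    moreover have "\<not> lt m0 m0" using lt unfolding monomial_ordering_def by (meson irreflpD)
    ultimately have m0: "weight n m0 = weight n m"
      "\<And>x. weight n x = weight n m0 \<Longrightarrow> \<not> lt x m0"
      unfolding F_def by auto
    have "m0 = m"
      using uniq[OF m0(1)] least_standard[OF _ m0(2)] no unfolding m_def by blast
    then show False using m0(2) m' by blast
  qed
  have "leading_ideal lt (toric_ideal n) \<subseteq> leading_ideal lt G"
    unfolding leading_ideal_def
  proof (rule self.span_minimal)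
    show "(\<lambda>p :: ('v, 'a) mpoly. Poly_Mapping.single (leading_monomial lt p) (1::'a)) ` (toric_ideal n - {0})
      \<subseteq> ideal_generated ((\<lambda>p. Poly_Mapping.single (leading_monomial lt p) 1) ` (G - {0}))"
    proof (rule image_subsetI)
      fix p :: "('v, 'a) mpoly" assume p: "p \<in> toric_ideal n - {0}"
      then obtain g c where gc: "g \<in> G" "leading_monomial lt p = c + leading_monomial lt g"
        using divisible by blast
      then have "Poly_Mapping.single (leading_monomial lt p) (1::'a)
          = Poly_Mapping.single c 1 * Poly_Mapping.single (leading_monomial lt g) 1"
        by (simp add: mult_single)
      moreover have "Poly_Mapping.single (leading_monomial lt g) (1::'a)
          \<in> ideal_generated ((\<lambda>p. Poly_Mapping.single (leading_monomial lt p) (1::'a)) ` (G - {0}))"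
        using \<open>g \<in> G\<close> nz by (intro self.span_base) blast
      ultimately show "Poly_Mapping.single (leading_monomial lt p) (1::'a)
          \<in> ideal_generated ((\<lambda>p. Poly_Mapping.single (leading_monomial lt p) (1::'a)) ` (G - {0}))"
        by (simp add: self.span_scale)
    qed
  qed (rule self.subspace_span)
  moreover have "leading_ideal lt G \<subseteq> leading_ideal lt (toric_ideal n)"
    unfolding leading_ideal_def using G_sub by (intro self.span_mono image_mono) auto
  ultimately show ?thesis using \<open>finite G\<close> G_sub by (simp add: standard_basis_def)
qed

text \<open>The leading exponent \<open>u\<close> is an argument, and both signs are allowed because
  the leading monomial stands second in several of the binomials.\<close>

definition homogeneous_binomial ::
  "('v::finite \<Rightarrow> nat) \<Rightarrow> ('v mon \<Rightarrow> 'v mon \<Rightarrow> bool) \<Rightarrow> ('v, 'a::comm_ring_1) mpoly \<Rightarrow> 'v mon \<Rightarrow> bool"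
  where "homogeneous_binomial n lt g u \<longleftrightarrow> (\<exists>v. weight n u = weight n v \<and> lt v u \<and>
     (g = Poly_Mapping.single u 1 - Poly_Mapping.single v 1 \<or>
      g = Poly_Mapping.single v 1 - Poly_Mapping.single u 1))"

lemma leading_monomial_homogeneous_binomial:
  assumes "monomial_ordering lt" "homogeneous_binomial n lt g u"
  shows "leading_monomial lt g = u"
proof -
  from assms(2) obtain v where v: "lt v u"
    "g = Poly_Mapping.single u 1 - Poly_Mapping.single v 1 \<or>
     g = Poly_Mapping.single v 1 - Poly_Mapping.single u 1"
    unfolding homogeneous_binomial_def by blast
  have "v \<noteq> u" using v(1) assms(1) unfolding monomial_ordering_def by (metis irreflpD)
  then have "Poly_Mapping.keys g = {u, v}" using v(2) keys_binomial by (metis insert_commute)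
  then show ?thesis using v(1) by (intro leading_monomial_eqI assms(1)) auto
qed

text \<open>This form of the criterion works with the exponents \<open>u\<close> directly, so that
  \<open>leading_monomial\<close> need not be evaluated on concrete polynomials.\<close>

lemma standard_basis_homogeneous_binomials:
  fixes n :: "'v::finite \<Rightarrow> nat" and G :: "('v, 'a::comm_ring_1) mpoly set"
  assumes lt: "monomial_ordering lt" and pos: "\<And>i. 0 < n i" and "finite G"
    and binom: "\<And>g. g \<in> G \<Longrightarrow> \<exists>u. homogeneous_binomial n lt g u"
    and uniq: "\<And>m m'. weight n m = weight n m' \<Longrightarrow>
       (\<And>g u c. g \<in> G \<Longrightarrow> homogeneous_binomial n lt g u \<Longrightarrow> m \<noteq> c + u) \<Longrightarrow>
       (\<And>g u c. g \<in> G \<Longrightarrow> homogeneous_binomial n lt g u \<Longrightarrow> m' \<noteq> c + u) \<Longrightarrow> m = m'"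
  shows "standard_basis lt (toric_ideal n) G"
proof (rule standard_basis_if_standard_unique[OF lt pos \<open>finite G\<close>])
  fix g assume "g \<in> G"
  then obtain u v where "weight n u = weight n v" "lt v u"
    "g = Poly_Mapping.single u 1 - Poly_Mapping.single v 1 \<or>
     g = Poly_Mapping.single v 1 - Poly_Mapping.single u 1"
    using binom unfolding homogeneous_binomial_def by blast
  moreover have "v \<noteq> u"
    using \<open>lt v u\<close> lt unfolding monomial_ordering_def by (metis irreflpD)
  ultimately show "\<exists>u v. u \<noteq> v \<and> weight n u = weight n v \<and>
       g = Poly_Mapping.single u 1 - Poly_Mapping.single v 1"
    by metis
next
  fix m m'
  assume "weight n m = weight n m'"
    and m: "\<And>g c. g \<in> G \<Longrightarrow> m \<noteq> c + leading_monomial lt g"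
    and m': "\<And>g c. g \<in> G \<Longrightarrow> m' \<noteq> c + leading_monomial lt g"
  then show "m = m'"
  proof (intro uniq)
    fix g u c assume "g \<in> G" "homogeneous_binomial n lt g u"
    then show "m \<noteq> c + u" "m' \<noteq> c + u"
      using m m' leading_monomial_homogeneous_binomial[OF lt] by blast+
  qed
qed

section \<open>The four-generated case\<close>

lemma X_power: "X i ^ e = (Poly_Mapping.single (Poly_Mapping.single i e) 1 :: ('v, 'a::comm_ring_1) mpoly)"
  by (induction e) (simp_all add: X_def mult_single flip: single_add)

lemma lookup_mon4 [simp]:
  "Poly_Mapping.lookup (mon4 e1 e2 e3 e4) 1 = e1" "Poly_Mapping.lookup (mon4 e1 e2 e3 e4) 2 = e2"
  "Poly_Mapping.lookup (mon4 e1 e2 e3 e4) 3 = e3" "Poly_Mapping.lookup (mon4 e1 e2 e3 e4) 4 = e4"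
  by (simp_all add: mon4_def lookup_add lookup_single)

lemma mon4_lookup:
  "mon4 (Poly_Mapping.lookup m 1) (Poly_Mapping.lookup m 2) (Poly_Mapping.lookup m 3)
     (Poly_Mapping.lookup m 4) = m"
proof (rule poly_mapping_eqI)
  fix i :: 4
  show "Poly_Mapping.lookup (mon4 (Poly_Mapping.lookup m 1) (Poly_Mapping.lookup m 2)
     (Poly_Mapping.lookup m 3) (Poly_Mapping.lookup m 4)) i = Poly_Mapping.lookup m i"
    using exhaust_4[of i] by (elim disjE) simp_all
qed

lemma mon4_add: "mon4 e1 e2 e3 e4 + mon4 f1 f2 f3 f4 = mon4 (e1 + f1) (e2 + f2) (e3 + f3) (e4 + f4)"
  by (simp add: mon4_def single_add algebra_simps)

lemma weight_mon4: "weight n (mon4 e1 e2 e3 e4) = e1 * n 1 + e2 * n 2 + e3 * n 3 + e4 * n 4"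
  by (simp add: weight_def sum_4)

lemma mdeg_mon4: "mdeg (mon4 e1 e2 e3 e4) = e1 + e2 + e3 + e4"
  by (simp add: mdeg_def sum_4)

lemma single_mon4:
  "(Poly_Mapping.single (mon4 e1 e2 e3 e4) 1 :: (4, 'a::comm_ring_1) mpoly)
    = X 1 ^ e1 * X 2 ^ e2 * X 3 ^ e3 * X 4 ^ e4"
  by (simp add: X_power mult_single mon4_def)

lemma homogeneous_binomial_mon4I:
  assumes "weight n (mon4 e1 e2 e3 e4) = weight n (mon4 f1 f2 f3 f4)"
    and "lt (mon4 f1 f2 f3 f4) (mon4 e1 e2 e3 e4)"
  shows "homogeneous_binomial n lt
      (X 1 ^ e1 * X 2 ^ e2 * X 3 ^ e3 * X 4 ^ e4 - X 1 ^ f1 * X 2 ^ f2 * X 3 ^ f3 * X 4 ^ f4)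
      (mon4 e1 e2 e3 e4)"
    and "homogeneous_binomial n lt
      (X 1 ^ f1 * X 2 ^ f2 * X 3 ^ f3 * X 4 ^ f4 - X 1 ^ e1 * X 2 ^ e2 * X 3 ^ e3 * X 4 ^ e4)
      (mon4 e1 e2 e3 e4)"
  using assms unfolding homogeneous_binomial_def single_mon4[symmetric] by blast+

text \<open>The last two generators are integral combinations of the first two, so a common divisor
  of the first two divides all four.\<close>

lemma coprime_first_two_generators:
  fixes n :: "4 \<Rightarrow> nat"
  assumes "Gcd (range n) = 1"
    and "int (n 3) = int (n 1) * x - y * int (n 2)" "int (n 4) = z * int (n 2) - int (n 1) * w"
  shows "coprime (int (n 1)) (int (n 2))"
proof (rule coprimeI)
  fix e assume "e dvd int (n 1)" "e dvd int (n 2)"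
  moreover from this have "e dvd int (n 3)" "e dvd int (n 4)"
    unfolding assms by auto
  ultimately have "nat \<bar>e\<bar> dvd n i" for i
    using exhaust_4[of i] by (elim disjE) (simp_all add: nat_abs_dvd_iff)
  then have "nat \<bar>e\<bar> dvd Gcd (range n)" by (intro Gcd_greatest) auto
  then show "is_unit e" using assms(1) by (simp add: nat_eq_iff)
qed

theorem theorem3p7:
  fixes n :: "4 \<Rightarrow> nat"
    and \<alpha>1 \<alpha>2 \<alpha>3 \<alpha>4 \<alpha>21 k s l :: nat
    and lt :: "4 mon \<Rightarrow> 4 mon \<Rightarrow> bool"
  assumes "minimal_generators n"
    and "pseudo_symmetric (generated_semigroup n)"
    and "pseudo_symmetric_parameters n \<alpha>1 \<alpha>2 \<alpha>3 \<alpha>4 \<alpha>21"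
    and "\<alpha>4 = 3"
    and "n 1 < n 2" and "n 2 < n 3" and "n 3 < n 4"
    and "\<alpha>2 > \<alpha>21 + 1"
    and "is_least k {k. k \<ge> 1 \<and> (k - 1) * \<alpha>1 + (k + 1) * \<alpha>21 + \<alpha>3 > k * \<alpha>2 + (k + 1)}"
    and "is_least s {s. s * \<alpha>1 + (2 * s + 2) * \<alpha>21 + \<alpha>3 > (2 * s + 1) * \<alpha>2 + (s + 2)}"
    and "is_least l {l. l * \<alpha>1 + (2 * l + 3) * \<alpha>21 + \<alpha>3 > (2 * l + 2) * \<alpha>2 + (l + 1)}"
    and "local_degree_ordering lt"
    and "\<And>i. i < s \<Longrightarrow>
          mdeg (mon4 0 ((2 * i + 1) * \<alpha>2 + 1) 0 1) =
          mdeg (mon4 (i * \<alpha>1 + (2 * i + 2) * \<alpha>21 + 1) 0 (\<alpha>3 - (i + 1)) 0) \<Longrightarrow>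
          lt (mon4 0 ((2 * i + 1) * \<alpha>2 + 1) 0 1)
             (mon4 (i * \<alpha>1 + (2 * i + 2) * \<alpha>21 + 1) 0 (\<alpha>3 - (i + 1)) 0)"
    and "\<And>j. s \<le> j \<Longrightarrow> j < l \<Longrightarrow>
          mdeg (mon4 0 ((2 * j + 2) * \<alpha>2 + 1) 0 0) =
          mdeg (mon4 (j * \<alpha>1 + (2 * j + 3) * \<alpha>21 + 1) 0 (\<alpha>3 - (j + 1)) 0) \<Longrightarrow>
          lt (mon4 0 ((2 * j + 2) * \<alpha>2 + 1) 0 0)
             (mon4 (j * \<alpha>1 + (2 * j + 3) * \<alpha>21 + 1) 0 (\<alpha>3 - (j + 1)) 0)"
  shows "standard_basis lt (toric_ideal n :: (4, 'a::alg_closed_field) mpoly set)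
    ({X 1 ^ \<alpha>1 - X 3 * X 4 ^ 2,
      X 2 ^ \<alpha>2 - X 1 ^ \<alpha>21 * X 4,
      X 3 ^ \<alpha>3 - X 1 ^ (\<alpha>1 - \<alpha>21 - 1) * X 2,
      X 4 ^ 3 - X 1 * X 2 ^ (\<alpha>2 - 1) * X 3 ^ (\<alpha>3 - 1),
      X 1 ^ (\<alpha>21 + 1) * X 3 ^ (\<alpha>3 - 1) - X 2 * X 4 ^ 2,
      X 1 ^ (\<alpha>1 + \<alpha>21) - X 2 ^ \<alpha>2 * X 3 * X 4,
      X 1 ^ (\<alpha>1 + 2 * \<alpha>21) - X 2 ^ (2 * \<alpha>2) * X 3}
     \<union> (\<lambda>i. X 2 ^ ((2 * i + 1) * \<alpha>2 + 1) * X 4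
             - X 1 ^ (i * \<alpha>1 + (2 * i + 2) * \<alpha>21 + 1) * X 3 ^ (\<alpha>3 - (i + 1))) ` {0..s}
     \<union> (\<lambda>j. X 2 ^ ((2 * j + 2) * \<alpha>2 + 1)
             - X 1 ^ (j * \<alpha>1 + (2 * j + 3) * \<alpha>21 + 1) * X 3 ^ (\<alpha>3 - (j + 1))) ` {s..l})"
proof -

  \<comment> \<open>The generators as integer polynomials in the parameters\<close>
  note par = assms(3)[unfolded pseudo_symmetric_parameters_def \<open>\<alpha>4 = 3\<close>]
  have lt: "monomial_ordering lt" and lt_deg: "\<And>u v. mdeg u < mdeg v \<Longrightarrow> lt v u"
    using assms(12) unfolding local_degree_ordering_def by auto
  define a b c d where "a = int \<alpha>1" and "b = int \<alpha>21" and "c = int \<alpha>3" and "d = int \<alpha>2"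
  note abcd_def = a_def b_def c_def d_def
  have abcd: "0 < b" "b + 1 < a" "2 \<le> c" "b + 2 \<le> d"
    using par assms(8) unfolding abcd_def by auto
  have n1: "int (n 1) = 2*d*c + 1"
    using par unfolding abcd_def by simp
  have "int (\<alpha>1 - \<alpha>21 - 1) = a - b - 1" "int (\<alpha>3 - 1) = c - 1" "int (\<alpha>2 - 1) = d - 1"
    using par unfolding abcd_def by auto
  note diffs = this
  have "n 2 = \<alpha>21 * \<alpha>3 * 3 + (\<alpha>1 - \<alpha>21 - 1) * (\<alpha>3 - 1) + \<alpha>3"
    using par by simp
  then have "int (n 2) = b * c * 3 + (a - b - 1) * (c - 1) + c"
    by (simp only: of_nat_add of_nat_mult diffs) (simp add: abcd_def)
  then have n2: "int (n 2) = 2*b*c + a*c - a + b + 1" by (simp add: algebra_simps)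
  \<comment> \<open>Adding 3 removes the truncated subtraction of \<alpha>4 from the formula for
    \<open>n 3\<close>.\<close>
  have "n 3 + 3 = \<alpha>1 * 3 + (\<alpha>1 - \<alpha>21 - 1) * (\<alpha>2 - 1) * 2 + 1"
    using par by simp
  then have "int (n 3 + 3) = int (\<alpha>1 * 3 + (\<alpha>1 - \<alpha>21 - 1) * (\<alpha>2 - 1) * 2 + 1)"
    by (rule arg_cong)
  then have "int (n 3) + 3 = a * 3 + (a - b - 1) * (d - 1) * 2 + 1"
    by (simp only: of_nat_add of_nat_mult diffs) (simp add: abcd_def)
  then have n3: "int (n 3) = a + 2*a*d - 2*b*d + 2*b - 2*d" by (simp add: algebra_simps)
  have "n 4 = \<alpha>1 * \<alpha>2 * (\<alpha>3 - 1) + \<alpha>21 * (\<alpha>2 - 1) + \<alpha>2"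
    using par by simp
  then have "int (n 4) = a * d * (c - 1) + b * (d - 1) + d"
    by (simp only: of_nat_add of_nat_mult diffs) (simp add: abcd_def)
  then have n4: "int (n 4) = a*d*c - a*d + b*d - b + d" by (simp add: algebra_simps)
  note ns = n1 n2 n3 n4
  have order: "2*d*c + 1 < 2*b*c + a*c - a + b + 1"
    "2*b*c + a*c - a + b + 1 < a + 2*a*d - 2*b*d + 2*b - 2*d"
    "a + 2*a*d - 2*b*d + 2*b - 2*d < a*d*c - a*d + b*d - b + d"
    using assms(5-7) unfolding ns[symmetric] by auto
  note bounds = parameter_bounds[OF abcd order]
  have cop: "coprime (2*d*c + 1) (2*b*c + a*c - a + b + 1)"
    unfolding ns[symmetric]
  proof (rule coprime_first_two_generators)
    show "Gcd (range n) = 1" using assms(1) unfolding minimal_generators_def by simp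
    show "int (n 3) = int (n 1) * (a + 2*b) - 2*d * int (n 2)"
      "int (n 4) = d * int (n 2) - int (n 1) * b"
      unfolding ns by (simp_all add: algebra_simps)
  qed
  have "0 < n 1" using par by simp
  then have pos: "0 < n i" for i
    using exhaust_4[of i] assms(5-7) by (elim disjE) simp_all

  \<comment> \<open>Range of the indices s and l\<close>
  have s_in: "s * \<alpha>1 + (2 * s + 2) * \<alpha>21 + \<alpha>3 > (2 * s + 1) * \<alpha>2 + (s + 2)"
    and s_least: "\<And>i. i * \<alpha>1 + (2 * i + 2) * \<alpha>21 + \<alpha>3 > (2 * i + 1) * \<alpha>2 + (i + 2) \<Longrightarrow> s \<le> i"
    and l_in: "l * \<alpha>1 + (2 * l + 3) * \<alpha>21 + \<alpha>3 > (2 * l + 2) * \<alpha>2 + (l + 1)"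
    and l_least: "\<And>j. j * \<alpha>1 + (2 * j + 3) * \<alpha>21 + \<alpha>3 > (2 * j + 2) * \<alpha>2 + (j + 1) \<Longrightarrow> l \<le> j"
    using assms(10,11) unfolding is_least_def by blast+
  \<comment> \<open>Since \<alpha>2 exceeds \<alpha>21 + 1, the inequality defining l implies the
    one defining s at the same index.\<close>
  have "s \<le> l"
    using l_in assms(8) by (intro s_least) (simp add: algebra_simps)
  \<comment> \<open>At the index \<alpha>3 - 1 the inequality defining l is precisely n 1 < n 2.
    Hence every exponent \<alpha>3 - (j + 1) with j <= l is a genuine difference.\<close>
  have "l \<le> \<alpha>3 - 1"
  proof (rule l_least)
    define c' where "c' = \<alpha>3 - 1"
    have c: "\<alpha>3 = c' + 1" using par unfolding c'_def by simp
    have "2 * int \<alpha>2 * (int c' + 1) + int \<alpha>1 < 2 * int \<alpha>21 * (int c' + 1) + int \<alpha>1 * (int c' + 1) + int \<alpha>21"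
      using order(1) unfolding abcd_def c by (simp add: algebra_simps)
    then have "int (2 * \<alpha>2 * (c' + 1) + \<alpha>1) < int (2 * \<alpha>21 * (c' + 1) + \<alpha>1 * (c' + 1) + \<alpha>21)"
      by (simp add: algebra_simps)
    then have "2 * \<alpha>2 * (c' + 1) + \<alpha>1 < 2 * \<alpha>21 * (c' + 1) + \<alpha>1 * (c' + 1) + \<alpha>21"
      by (simp only: of_nat_less_iff)
    then show "(\<alpha>3 - 1) * \<alpha>1 + (2 * (\<alpha>3 - 1) + 3) * \<alpha>21 + \<alpha>3
        > (2 * (\<alpha>3 - 1) + 2) * \<alpha>2 + ((\<alpha>3 - 1) + 1)"
      unfolding c by (simp add: algebra_simps)
  qed
  then have l_less: "l < \<alpha>3" using abcd(3) unfolding c_def by linarith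

  \<comment> \<open>list positions start at 0, so \<open>f k\<close> is the polynomial \<open>f\<close> of the theorem with index \<open>k + 1\<close>\<close>
  define f where "f k = ([X 1 ^ \<alpha>1 - X 3 * X 4 ^ 2,
      X 2 ^ \<alpha>2 - X 1 ^ \<alpha>21 * X 4,
      X 3 ^ \<alpha>3 - X 1 ^ (\<alpha>1 - \<alpha>21 - 1) * X 2,
      X 4 ^ 3 - X 1 * X 2 ^ (\<alpha>2 - 1) * X 3 ^ (\<alpha>3 - 1),
      X 1 ^ (\<alpha>21 + 1) * X 3 ^ (\<alpha>3 - 1) - X 2 * X 4 ^ 2,
      X 1 ^ (\<alpha>1 + \<alpha>21) - X 2 ^ \<alpha>2 * X 3 * X 4,
      X 1 ^ (\<alpha>1 + 2 * \<alpha>21) - X 2 ^ (2 * \<alpha>2) * X 3] :: (4, 'a) mpoly list) ! k" for k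
  define g where "g i = (X 2 ^ ((2 * i + 1) * \<alpha>2 + 1) * X 4
             - X 1 ^ (i * \<alpha>1 + (2 * i + 2) * \<alpha>21 + 1) * X 3 ^ (\<alpha>3 - (i + 1)) :: (4, 'a) mpoly)" for i
  define h where "h j = (X 2 ^ ((2 * j + 2) * \<alpha>2 + 1)
             - X 1 ^ (j * \<alpha>1 + (2 * j + 3) * \<alpha>21 + 1) * X 3 ^ (\<alpha>3 - (j + 1)) :: (4, 'a) mpoly)" for j
  define G where "G = f ` {..<7} \<union> g ` {0..s} \<union> h ` {s..l}"

  \<comment> \<open>Homogeneity and leading monomials of the binomials\<close>
  have weight_eqI: "weight n (mon4 e1 e2 e3 e4) = weight n (mon4 e1' e2' e3' e4')"
    if "int e1 * int (n 1) + int e2 * int (n 2) + int e3 * int (n 3) + int e4 * int (n 4)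
      = int e1' * int (n 1) + int e2' * int (n 2) + int e3' * int (n 3) + int e4' * int (n 4)"
    for e1 e2 e3 e4 e1' e2' e3' e4'
    using that unfolding weight_mon4
    by (simp only: of_nat_mult[symmetric] of_nat_add[symmetric] of_nat_eq_iff)
  let ?hb = "homogeneous_binomial n lt :: (4, 'a) mpoly \<Rightarrow> _"

  \<comment> \<open>For all seven of these binomials the degree gap is strict, by
    \<open>bounds\<close> or \<open>abcd\<close>, so \<open>lt_deg\<close> settles the leading
    monomial.\<close>
  have f0: "?hb (f 0) (mon4 0 0 1 2)"
  proof -
    have "weight n (mon4 0 0 1 2) = weight n (mon4 \<alpha>1 0 0 0)"
      by (rule weight_eqI) (simp add: ns algebra_simps flip: abcd_def)
    moreover have "lt (mon4 \<alpha>1 0 0 0) (mon4 0 0 1 2)"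
      using bounds unfolding abcd_def by (intro lt_deg) (simp add: mdeg_mon4)
    ultimately show ?thesis
      using homogeneous_binomial_mon4I(2)[of n 0 0 1 2 \<alpha>1 0 0 0 lt] by (simp add: f_def)
  qed
  have f1: "?hb (f 1) (mon4 \<alpha>21 0 0 1)"
  proof -
    have "weight n (mon4 \<alpha>21 0 0 1) = weight n (mon4 0 \<alpha>2 0 0)"
      by (rule weight_eqI) (simp add: ns algebra_simps flip: abcd_def)
    moreover have "lt (mon4 0 \<alpha>2 0 0) (mon4 \<alpha>21 0 0 1)"
      using abcd unfolding abcd_def by (intro lt_deg) (simp add: mdeg_mon4)
    ultimately show ?thesis
      using homogeneous_binomial_mon4I(2)[of n \<alpha>21 0 0 1 0 \<alpha>2 0 0 lt] by (simp add: f_def)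
  qed
  have f2: "?hb (f 2) (mon4 0 0 \<alpha>3 0)"
  proof -
    have "weight n (mon4 0 0 \<alpha>3 0) = weight n (mon4 (\<alpha>1 - \<alpha>21 - 1) 1 0 0)"
      by (rule weight_eqI) (simp only: diffs ns, simp add: algebra_simps flip: abcd_def)
    moreover have "lt (mon4 (\<alpha>1 - \<alpha>21 - 1) 1 0 0) (mon4 0 0 \<alpha>3 0)"
      using bounds abcd unfolding abcd_def by (intro lt_deg) (simp add: mdeg_mon4)
    ultimately show ?thesis
      using homogeneous_binomial_mon4I(1)[of n 0 0 \<alpha>3 0 "\<alpha>1 - \<alpha>21 - 1" 1 0 0 lt]
      by (simp add: f_def)
  qed
  have f3: "?hb (f 3) (mon4 0 0 0 3)"
  proof -
    have "weight n (mon4 0 0 0 3) = weight n (mon4 1 (\<alpha>2 - 1) (\<alpha>3 - 1) 0)"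
      by (rule weight_eqI) (simp only: diffs ns, simp add: algebra_simps)
    moreover have "lt (mon4 1 (\<alpha>2 - 1) (\<alpha>3 - 1) 0) (mon4 0 0 0 3)"
      using abcd unfolding abcd_def by (intro lt_deg) (simp add: mdeg_mon4)
    ultimately show ?thesis
      using homogeneous_binomial_mon4I(1)[of n 0 0 0 3 1 "\<alpha>2 - 1" "\<alpha>3 - 1" 0 lt]
      by (simp add: f_def)
  qed
  have f4: "?hb (f 4) (mon4 0 1 0 2)"
  proof -
    have "weight n (mon4 0 1 0 2) = weight n (mon4 (\<alpha>21 + 1) 0 (\<alpha>3 - 1) 0)"
      by (rule weight_eqI) (simp only: diffs ns, simp add: algebra_simps flip: abcd_def)
    moreover have "lt (mon4 (\<alpha>21 + 1) 0 (\<alpha>3 - 1) 0) (mon4 0 1 0 2)"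
      using bounds abcd unfolding abcd_def by (intro lt_deg) (simp add: mdeg_mon4)
    ultimately show ?thesis
      using homogeneous_binomial_mon4I(2)[of n 0 1 0 2 "\<alpha>21 + 1" 0 "\<alpha>3 - 1" 0 lt]
      by (simp add: f_def)
  qed
  have f5: "?hb (f 5) (mon4 0 \<alpha>2 1 1)"
  proof -
    have "weight n (mon4 0 \<alpha>2 1 1) = weight n (mon4 (\<alpha>1 + \<alpha>21) 0 0 0)"
      by (rule weight_eqI) (simp add: ns algebra_simps flip: abcd_def)
    moreover have "lt (mon4 (\<alpha>1 + \<alpha>21) 0 0 0) (mon4 0 \<alpha>2 1 1)"
      using bounds abcd unfolding abcd_def by (intro lt_deg) (simp add: mdeg_mon4)
    ultimately show ?thesis
      using homogeneous_binomial_mon4I(2)[of n 0 \<alpha>2 1 1 "\<alpha>1 + \<alpha>21" 0 0 0 lt]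
      by (simp add: f_def)
  qed
  have f6: "?hb (f 6) (mon4 0 (2 * \<alpha>2) 1 0)"
  proof -
    have "weight n (mon4 0 (2 * \<alpha>2) 1 0) = weight n (mon4 (\<alpha>1 + 2 * \<alpha>21) 0 0 0)"
      by (rule weight_eqI) (simp add: ns algebra_simps flip: abcd_def)
    moreover have "lt (mon4 (\<alpha>1 + 2 * \<alpha>21) 0 0 0) (mon4 0 (2 * \<alpha>2) 1 0)"
      using bounds abcd unfolding abcd_def by (intro lt_deg) (simp add: mdeg_mon4)
    ultimately show ?thesis
      using homogeneous_binomial_mon4I(2)[of n 0 "2 * \<alpha>2" 1 0 "\<alpha>1 + 2 * \<alpha>21" 0 0 0 lt]
      by (simp add: f_def)
  qed

  \<comment> \<open>In the coordinates of \<open>kernel_lattice\<close>, the monomial in X1 and X3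
    differs from the other one by r = 1 and p = i + 1, with last entry -1; for \<open>h\<close> the
    last entry is 0.\<close>
  have g_weight: "weight n (mon4 0 ((2 * i + 1) * \<alpha>2 + 1) 0 1)
      = weight n (mon4 (i * \<alpha>1 + (2 * i + 2) * \<alpha>21 + 1) 0 (\<alpha>3 - (i + 1)) 0)" if "i < \<alpha>3" for i
  proof (rule weight_eqI)
    have "int (\<alpha>3 - (i + 1)) = c - (int i + 1)" using that by (simp add: c_def of_nat_diff)
    then show "int 0 * int (n 1) + int ((2 * i + 1) * \<alpha>2 + 1) * int (n 2) + int 0 * int (n 3)
        + int 1 * int (n 4)
      = int (i * \<alpha>1 + (2 * i + 2) * \<alpha>21 + 1) * int (n 1) + int 0 * int (n 2)
        + int (\<alpha>3 - (i + 1)) * int (n 3) + int 0 * int (n 4)"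
      by (simp only: ns) (simp add: algebra_simps flip: abcd_def)
  qed
  have h_weight: "weight n (mon4 0 ((2 * j + 2) * \<alpha>2 + 1) 0 0)
      = weight n (mon4 (j * \<alpha>1 + (2 * j + 3) * \<alpha>21 + 1) 0 (\<alpha>3 - (j + 1)) 0)" if "j < \<alpha>3" for j
  proof (rule weight_eqI)
    have "int (\<alpha>3 - (j + 1)) = c - (int j + 1)" using that by (simp add: c_def of_nat_diff)
    then show "int 0 * int (n 1) + int ((2 * j + 2) * \<alpha>2 + 1) * int (n 2) + int 0 * int (n 3)
        + int 0 * int (n 4)
      = int (j * \<alpha>1 + (2 * j + 3) * \<alpha>21 + 1) * int (n 1) + int 0 * int (n 2)
        + int (\<alpha>3 - (j + 1)) * int (n 3) + int 0 * int (n 4)"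
      by (simp only: ns) (simp add: algebra_simps flip: abcd_def)
  qed
  have g_lead: "?hb (g i) (mon4 (i * \<alpha>1 + (2 * i + 2) * \<alpha>21 + 1) 0 (\<alpha>3 - (i + 1)) 0)"
    if "i < s" for i
  proof -
    have i: "i < \<alpha>3" using that \<open>s \<le> l\<close> l_less by simp
    \<comment> \<open>Minimality of s yields only a weak degree inequality below s;
      \<open>assms(13)\<close> settles a tie.\<close>
    have "\<not> (2 * i + 1) * \<alpha>2 + (i + 2) < i * \<alpha>1 + (2 * i + 2) * \<alpha>21 + \<alpha>3"
      using s_least[of i] that by linarith
    then have "mdeg (mon4 (i * \<alpha>1 + (2 * i + 2) * \<alpha>21 + 1) 0 (\<alpha>3 - (i + 1)) 0)
        \<le> mdeg (mon4 0 ((2 * i + 1) * \<alpha>2 + 1) 0 1)"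
      using i unfolding mdeg_mon4 by linarith
    then have "lt (mon4 0 ((2 * i + 1) * \<alpha>2 + 1) 0 1)
        (mon4 (i * \<alpha>1 + (2 * i + 2) * \<alpha>21 + 1) 0 (\<alpha>3 - (i + 1)) 0)"
      using lt_deg assms(13)[OF that] by (metis nless_le)
    from homogeneous_binomial_mon4I(2)[where lt = lt, OF g_weight[OF i, symmetric] this]
    show ?thesis by (simp only: g_def power_0 power_one_right mult_1_left mult_1_right)
  qed
  have h_lead: "?hb (h j) (mon4 (j * \<alpha>1 + (2 * j + 3) * \<alpha>21 + 1) 0 (\<alpha>3 - (j + 1)) 0)"
    if "s \<le> j" "j < l" for j
  proof -
    have j: "j < \<alpha>3" using that l_less by simp
    have "\<not> (2 * j + 2) * \<alpha>2 + (j + 1) < j * \<alpha>1 + (2 * j + 3) * \<alpha>21 + \<alpha>3"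
      using l_least[of j] that by linarith
    then have "mdeg (mon4 (j * \<alpha>1 + (2 * j + 3) * \<alpha>21 + 1) 0 (\<alpha>3 - (j + 1)) 0)
        \<le> mdeg (mon4 0 ((2 * j + 2) * \<alpha>2 + 1) 0 0)"
      using j unfolding mdeg_mon4 by linarith
    then have "lt (mon4 0 ((2 * j + 2) * \<alpha>2 + 1) 0 0)
        (mon4 (j * \<alpha>1 + (2 * j + 3) * \<alpha>21 + 1) 0 (\<alpha>3 - (j + 1)) 0)"
      using lt_deg assms(14)[OF that] by (metis nless_le)
    from homogeneous_binomial_mon4I(2)[where lt = lt, OF h_weight[OF j, symmetric] this]
    show ?thesis by (simp only: h_def power_0 power_one_right mult_1_left mult_1_right)
  qed
  have gs: "?hb (g s) (mon4 0 ((2 * s + 1) * \<alpha>2 + 1) 0 1)"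
  proof -
    have s: "s < \<alpha>3" using \<open>s \<le> l\<close> l_less by simp
    \<comment> \<open>At the index s the inequality holds strictly, so the leading monomial switches
      to the other term.\<close>
    have "lt (mon4 (s * \<alpha>1 + (2 * s + 2) * \<alpha>21 + 1) 0 (\<alpha>3 - (s + 1)) 0)
        (mon4 0 ((2 * s + 1) * \<alpha>2 + 1) 0 1)"
      using s s_in by (intro lt_deg, unfold mdeg_mon4) linarith
    from homogeneous_binomial_mon4I(1)[where lt = lt, OF g_weight[OF s] this]
    show ?thesis by (simp only: g_def power_0 power_one_right mult_1_left mult_1_right)
  qed
  have hl: "?hb (h l) (mon4 0 ((2 * l + 2) * \<alpha>2 + 1) 0 0)"
  proof -
    have "lt (mon4 (l * \<alpha>1 + (2 * l + 3) * \<alpha>21 + 1) 0 (\<alpha>3 - (l + 1)) 0)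
        (mon4 0 ((2 * l + 2) * \<alpha>2 + 1) 0 0)"
      using l_less l_in by (intro lt_deg, unfold mdeg_mon4) linarith
    from homogeneous_binomial_mon4I(1)[where lt = lt, OF h_weight[OF l_less] this]
    show ?thesis by (simp only: h_def power_0 power_one_right mult_1_left mult_1_right)
  qed

  \<comment> \<open>Standard monomials of G and their weights\<close>
  have lessThan_7: "{..<7::nat} = {0, 1, 2, 3, 4, 5, 6}" by auto
  have "standard_basis lt (toric_ideal n) G"
  proof (rule standard_basis_homogeneous_binomials[OF lt pos])
    show "finite G" by (simp add: G_def)
    fix p assume "p \<in> G"
    then consider "p \<in> {f 0, f 1, f 2, f 3, f 4, f 5, f 6}" | i where "i \<le> s" "p = g i"
      | j where "s \<le> j" "j \<le> l" "p = h j"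
      unfolding G_def lessThan_7 by auto
    then show "\<exists>u. ?hb p u"
    proof cases
      case 1
      then show ?thesis using f0 f1 f2 f3 f4 f5 f6 by blast
    next
      case (2 i)
      then show ?thesis using g_lead gs by (cases "i = s") (auto intro: le_neq_trans)
    next
      case (3 j)
      then show ?thesis using h_lead hl by (cases "j = l") (auto intro: le_neq_trans)
    qed
  next
    have standard: "standard_exponents a b c d (int s) (int l)
        (int (Poly_Mapping.lookup m 1)) (int (Poly_Mapping.lookup m 2))
        (int (Poly_Mapping.lookup m 3)) (int (Poly_Mapping.lookup m 4))"
      if m: "\<And>p u t. p \<in> G \<Longrightarrow> ?hb p u \<Longrightarrow> m \<noteq> t + u" for m
    proof -
      define x1 x2 x3 x4 where x_def: "x1 = Poly_Mapping.lookup m 1" "x2 = Poly_Mapping.lookup m 2"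
        "x3 = Poly_Mapping.lookup m 3" "x4 = Poly_Mapping.lookup m 4"
      \<comment> \<open>Componentwise domination of exponents is divisibility of monomials.\<close>
      have nd: "\<not> (e1 \<le> x1 \<and> e2 \<le> x2 \<and> e3 \<le> x3 \<and> e4 \<le> x4)"
        if "?hb p (mon4 e1 e2 e3 e4)" "p \<in> G" for p e1 e2 e3 e4
      proof
        assume "e1 \<le> x1 \<and> e2 \<le> x2 \<and> e3 \<le> x3 \<and> e4 \<le> x4"
        then have "m = mon4 (x1 - e1) (x2 - e2) (x3 - e3) (x4 - e4) + mon4 e1 e2 e3 e4"
          using mon4_lookup[of m] by (simp add: mon4_add x_def)
        then show False using m that by blast
      qed
      have f_in: "f k \<in> G" if "k < 7" for k using that by (auto simp: G_def)
      have g_in: "g i \<in> G" if "i \<le> s" for i using that by (auto simp: G_def)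
      have h_in: "h j \<in> G" if "s \<le> j" "j \<le> l" for j using that by (auto simp: G_def)
      have stair_g: "\<not> (i*a + (2*i + 2)*b + 1 \<le> int x1 \<and> c - (i + 1) \<le> int x3)"
        if i: "0 \<le> i \<and> i < int s" for i
      proof -
        from i obtain i' where i': "i = int i'" "i' < s" by (metis nonneg_int_cases of_nat_less_iff)
        have "\<not> (i' * \<alpha>1 + (2 * i' + 2) * \<alpha>21 + 1 \<le> x1 \<and> \<alpha>3 - (i' + 1) \<le> x3)"
          using nd[OF g_lead[OF i'(2)] g_in] i'(2) by simp
        \<comment> \<open>The exponent x3 is nonnegative, so truncated and integer subtraction give
          equivalent conditions.\<close>
        then have "\<not> (int (i' * \<alpha>1 + (2 * i' + 2) * \<alpha>21 + 1) \<le> int x1 \<and> int \<alpha>3 - (int i' + 1) \<le> int x3)"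
          by (simp only: of_nat_le_iff) linarith
        then show ?thesis unfolding i' abcd_def by (simp add: algebra_simps)
      qed
      have stair_h: "\<not> (j*a + (2*j + 3)*b + 1 \<le> int x1 \<and> c - (j + 1) \<le> int x3)"
        if j: "int s \<le> j \<and> j < int l" for j
      proof -
        from j have "0 \<le> j" by simp
        with j obtain j' where j': "j = int j'" "s \<le> j'" "j' < l"
          by (metis nonneg_int_cases of_nat_less_iff of_nat_le_iff)
        have "\<not> (j' * \<alpha>1 + (2 * j' + 3) * \<alpha>21 + 1 \<le> x1 \<and> \<alpha>3 - (j' + 1) \<le> x3)"
          using nd[OF h_lead[OF j'(2,3)] h_in] j'(2,3) by simp
        then have "\<not> (int (j' * \<alpha>1 + (2 * j' + 3) * \<alpha>21 + 1) \<le> int x1 \<and> int \<alpha>3 - (int j' + 1) \<le> int x3)"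
          by (simp only: of_nat_le_iff) linarith
        then show ?thesis unfolding j' abcd_def by (simp add: algebra_simps)
      qed
      have "\<not> ((2 * s + 1) * \<alpha>2 + 1 \<le> x2 \<and> 1 \<le> x4)"
        using nd[OF gs g_in] by simp
      then have x2s: "\<not> ((2 * int s + 1)*d + 1 \<le> int x2 \<and> 1 \<le> int x4)"
        unfolding d_def by (metis (mono_tags) of_nat_1 of_nat_add of_nat_le_iff of_nat_mult of_nat_numeral)
      have "\<not> (2 * l + 2) * \<alpha>2 + 1 \<le> x2"
        using nd[OF hl h_in] \<open>s \<le> l\<close> by simp
      then have x2l: "int x2 < (2 * int l + 2)*d + 1"
        unfolding d_def by (metis (mono_tags) not_le of_nat_1 of_nat_add of_nat_less_iff of_nat_mult of_nat_numeral)
      have "\<not> (1 \<le> int x3 \<and> 2 \<le> int x4)" using nd[OF f0 f_in] by simp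
      moreover have "\<not> (b \<le> int x1 \<and> 1 \<le> int x4)"
        using nd[OF f1 f_in] unfolding b_def by simp
      moreover have "int x3 < c" using nd[OF f2 f_in] unfolding c_def by simp
      moreover have "int x4 < 3" using nd[OF f3 f_in] by simp
      moreover have "\<not> (1 \<le> int x2 \<and> 2 \<le> int x4)" using nd[OF f4 f_in] by simp
      moreover have "\<not> (d \<le> int x2 \<and> 1 \<le> int x3 \<and> 1 \<le> int x4)"
        using nd[OF f5 f_in] unfolding d_def by simp
      moreover have "\<not> (2*d \<le> int x2 \<and> 1 \<le> int x3)"
        using nd[OF f6 f_in] unfolding d_def by simp
      ultimately show ?thesis
        unfolding x_def[symmetric] standard_exponents_def using x2s x2l
        by (intro conjI allI impI of_nat_0_le_iff) (assumption | erule stair_g stair_h)+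
    qed
    fix m m' assume w: "weight n m = weight n m'"
      and m: "\<And>p u t. p \<in> G \<Longrightarrow> ?hb p u \<Longrightarrow> m \<noteq> t + u"
      and m': "\<And>p u t. p \<in> G \<Longrightarrow> ?hb p u \<Longrightarrow> m' \<noteq> t + u"
    have "int (weight n m) - int (weight n m') = 0" using w by simp
    then have "int (n 1) * (int (Poly_Mapping.lookup m 1) - int (Poly_Mapping.lookup m' 1))
        + int (n 2) * (int (Poly_Mapping.lookup m 2) - int (Poly_Mapping.lookup m' 2))
        + int (n 3) * (int (Poly_Mapping.lookup m 3) - int (Poly_Mapping.lookup m' 3))
        + int (n 4) * (int (Poly_Mapping.lookup m 4) - int (Poly_Mapping.lookup m' 4)) = 0"
      unfolding weight_def sum_4 by (simp add: algebra_simps)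
    note uniq = standard_exponents_unique[OF abcd _ _ _ cop standard standard this[unfolded ns]]
    have "int (Poly_Mapping.lookup m 1) = int (Poly_Mapping.lookup m' 1) \<and>
        int (Poly_Mapping.lookup m 2) = int (Poly_Mapping.lookup m' 2) \<and>
        int (Poly_Mapping.lookup m 3) = int (Poly_Mapping.lookup m' 3) \<and>
        int (Poly_Mapping.lookup m 4) = int (Poly_Mapping.lookup m' 4)"
      by (rule uniq) (use \<open>s \<le> l\<close> l_less m m' in \<open>simp_all add: c_def\<close>)
    then show "m = m'" unfolding of_nat_eq_iff by (metis mon4_lookup)
  qed
  moreover have "f ` {..<7} = {f 0, f 1, f 2, f 3, f 4, f 5, f 6}" unfolding lessThan_7 by simp
  ultimately show ?thesis unfolding G_def g_def h_def by (simp add: f_def)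
qed

end
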